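(* Let $n\ge 1$ be an integer and let $\alpha_1,\dots,\alpha_n,\beta_1,\dots,\beta_n$ be real numbers with $\alpha_i>0$ and $\beta_i>0$ for $i=1,\dots,n$. Let $$\tilde{\Phi}_n(\alpha,\beta)(t_1,\dots,t_n)=t_1^{\alpha_1}(1-t_1)^{\beta_1}\prod_{j=2}^n t_j^{\alpha_j}(t_{j-1}-t_j)^{\beta_j},$$ and let $\Delta_n=\{t\in\mathbb{R}^n\;|\;0<t_n<\dots<t_1<1\}$. Then $$\int_{\Delta_n}\tilde{\Phi}_n(\alpha,\beta)\,dt_1\cdots dt_n=\prod_{j=1}^n\frac{\Gamma(\beta_j+1)\,\Gamma(\alpha_j+\dots+\alpha_n+\beta_{j+1}+\dots+\beta_n+n-j+1)}{\Gamma(\alpha_j+\dots+\alpha_n+\beta_j+\dots+\beta_n+n-j+2)}.$$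
   Context: $\Gamma$ is Euler's Gamma function. On $\Delta_n$ all the bases $t_j$, $1-t_1$, $t_{j-1}-t_j$ are positive, and real powers of positive numbers are taken to be positive. For $j=n$ the sum $\beta_{j+1}+\dots+\beta_n$ is empty, i.e. equal to $0$. *)

theory Defs
  imports "HOL-Analysis.Analysis"
begin

text \<open>
  The space R^n is modelled by the real functions on the index set {1..n}, in the extensional
  representation used by \<^const>\<open>PiM\<close>, so that its Lebesgue measure is the product of n copies
  of \<^const>\<open>lborel\<close>.
\<close>

definition lebesgue_R :: "nat \<Rightarrow> (nat \<Rightarrow> real) measure" where
  "lebesgue_R n = PiM {1..n} (\<lambda>_. lborel)"

definition ordered_simplex :: "nat \<Rightarrow> (nat \<Rightarrow> real) set" where
  "ordered_simplex n =
     {t \<in> {1..n} \<rightarrow>\<^sub>E UNIV. 0 < t n \<and> (\<forall>j\<in>{2..n}. t j < t (j - 1)) \<and> t 1 < 1}"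

definition Phi_tilde :: "nat \<Rightarrow> (nat \<Rightarrow> real) \<Rightarrow> (nat \<Rightarrow> real) \<Rightarrow> (nat \<Rightarrow> real) \<Rightarrow> real" where
  "Phi_tilde n \<alpha> \<beta> t =
     t 1 powr \<alpha> 1 * (1 - t 1) powr \<beta> 1 *
       (\<Prod>j=2..n. t j powr \<alpha> j * (t (j - 1) - t j) powr \<beta> j)"

end

theory Submission
  imports Defs
begin

text \<open>
  Integrating out the last variable between \<open>0\<close> and \<open>t\<^sub>n\<^sub>-\<^sub>1\<close> is a Beta integral. By scaling it
  contributes the factor \<open>B(\<alpha>\<^sub>n + 1, \<beta>\<^sub>n + 1)\<close>, which is the last factor of the product, and a power
  \<open>\<alpha>\<^sub>n + \<beta>\<^sub>n + 1\<close> of \<open>t\<^sub>n\<^sub>-\<^sub>1\<close>. Absorbing that power into \<open>\<alpha>\<^sub>n\<^sub>-\<^sub>1\<close> leaves an integral of the same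
  kind in one variable fewer, whose Gamma factors are the remaining ones. Working with nonnegative
  integrals makes Tonelli applicable without integrability conditions.
\<close>

section \<open>The Beta integral over an interval\<close>

lemma Beta_real_pos: "a > 0 \<Longrightarrow> b > 0 \<Longrightarrow> Beta a b > (0::real)"
  by (simp add: Beta_def Gamma_real_pos)

text \<open>The substitution \<open>y = c * u\<close> reduces this to the unit interval: the two
  powers contribute \<open>c powr (a + b)\<close> and the Jacobian one more factor
  \<open>c\<close>.\<close>

lemma nn_integral_Beta_scaled:
  fixes a b c :: real
  assumes "a > -1" "b > -1" "c > 0"
  shows "(\<integral>\<^sup>+y. ennreal (y powr a * (c - y) powr b) * indicator {0<..<c} y \<partial>lborel) =
    ennreal (c powr (a + b + 1) * Beta (a + 1) (b + 1))"
proof -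
  have "((\<lambda>t. t powr a * (1 - t) powr b) has_integral Beta (a + 1) (b + 1)) {0..1}"
    using has_integral_Beta_real[of "a + 1" "b + 1"] assms by simp
  \<comment> \<open>Dropping the endpoints, a null set, gives the open interval that later occurs as
    a fibre of the simplex.\<close>
  then have "((\<lambda>t. t powr a * (1 - t) powr b) has_integral Beta (a + 1) (b + 1)) {0<..<1}"
    by (simp add: has_integral_Icc_iff_Ioo)
  then have "((\<lambda>t. if t \<in> {0<..<1} then t powr a * (1 - t) powr b else 0)
      has_integral Beta (a + 1) (b + 1)) UNIV"
    by (simp only: has_integral_restrict_UNIV)
  then have "(\<integral>\<^sup>+t. ennreal (if t \<in> {0<..<1} then t powr a * (1 - t) powr b else 0) \<partial>lborel) =
      ennreal (Beta (a + 1) (b + 1))"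
    by (intro nn_integral_has_integral_lborel) auto
  moreover have "(\<integral>\<^sup>+t. ennreal (if t \<in> {0<..<1} then t powr a * (1 - t) powr b else 0) \<partial>lborel) =
      (\<integral>\<^sup>+y. ennreal (y powr a * (1 - y) powr b) * indicator {0<..<1} y \<partial>lborel)"
    by (intro nn_integral_cong) (auto simp: indicator_def)
  ultimately have unit: "(\<integral>\<^sup>+y. ennreal (y powr a * (1 - y) powr b) * indicator {0<..<1} y \<partial>lborel) =
      ennreal (Beta (a + 1) (b + 1))"
    by simp
  have "(\<integral>\<^sup>+y. ennreal (y powr a * (c - y) powr b) * indicator {0<..<c} y \<partial>lborel) =
      ennreal \<bar>c\<bar> * (\<integral>\<^sup>+y. ennreal ((0 + c * y) powr a * (c - (0 + c * y)) powr b) *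
        indicator {0<..<c} (0 + c * y) \<partial>lborel)"
    using assms by (intro nn_integral_real_affine) auto
  also have "(\<integral>\<^sup>+y. ennreal ((0 + c * y) powr a * (c - (0 + c * y)) powr b) *
        indicator {0<..<c} (0 + c * y) \<partial>lborel) =
      (\<integral>\<^sup>+y. ennreal (c powr (a + b)) *
        (ennreal (y powr a * (1 - y) powr b) * indicator {0<..<1} y) \<partial>lborel)"
  proof (intro nn_integral_cong)
    fix y :: real
    \<comment> \<open>The power law is needed only where \<open>y\<close> and \<open>1 - y\<close>
      are positive; elsewhere both indicators vanish.\<close>
    have "(c * y) powr a * (c - c * y) powr b =
        c powr (a + b) * (y powr a * (1 - y) powr b)" if "0 < y" "y < 1"
    proof -
      have "c - c * y = c * (1 - y)" by (simp add: algebra_simps)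
      then show ?thesis using that assms by (simp add: powr_mult powr_add)
    qed
    moreover have "indicator {0<..<c} (0 + c * y) = (indicator {0<..<1} y :: ennreal)"
      using assms by (simp add: indicator_def zero_less_mult_iff)
    ultimately show "ennreal ((0 + c * y) powr a * (c - (0 + c * y)) powr b) *
        indicator {0<..<c} (0 + c * y) = ennreal (c powr (a + b)) *
        (ennreal (y powr a * (1 - y) powr b) * indicator {0<..<1} y)"
      by (cases "y \<in> {0<..<1}") (simp_all add: ennreal_mult'[symmetric])
  qed
  also have "\<dots> = ennreal (c powr (a + b)) * ennreal (Beta (a + 1) (b + 1))"
    unfolding unit[symmetric] by (intro nn_integral_cmult) simp
  finally show ?thesis
    using assms Beta_real_pos[of "a + 1" "b + 1"]
    by (simp add: powr_add ennreal_mult'[symmetric] mult_ac)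
qed

section \<open>Splitting off the last coordinate\<close>

definition simplex_ineqs :: "nat \<Rightarrow> (nat \<Rightarrow> real) \<Rightarrow> bool" where
  "simplex_ineqs n t \<longleftrightarrow> 0 < t n \<and> (\<forall>j\<in>{2..n}. t j < t (j - 1)) \<and> t 1 < 1"

text \<open>Separates the inequalities from extensionality, so that the update
  \<open>t(Suc n := y)\<close> can be studied without regard to the index set.\<close>

lemma ordered_simplex_eq:
  "ordered_simplex n = {t \<in> space (lebesgue_R n). simplex_ineqs n t}"
  by (auto simp: ordered_simplex_def simplex_ineqs_def lebesgue_R_def space_PiM)

lemma simplex_ineqs_Suc:
  assumes "n \<ge> 1"
  shows "simplex_ineqs (Suc n) (t(Suc n := y)) \<longleftrightarrow> simplex_ineqs n t \<and> y \<in> {0<..<t n}"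
proof -
  have "{2..Suc n} = insert (Suc n) {2..n}"
    using assms by auto
  moreover have "(\<forall>j\<in>{2..n}. (t(Suc n := y)) j < (t(Suc n := y)) (j - 1)) \<longleftrightarrow>
      (\<forall>j\<in>{2..n}. t j < t (j - 1))"
    \<comment> \<open>An index \<open>j\<close> in \<open>{2..n}\<close> keeps both \<open>j\<close>
      and \<open>j - 1\<close> away from \<open>Suc n\<close>, so the update is invisible
      here.\<close>
    by (intro ball_cong) auto
  \<comment> \<open>The larger system demands positivity of \<open>y\<close> only; that of
    \<open>t n\<close> must be recovered from the chain.\<close>
  moreover have "0 < t n" if "0 < y" "y < t n"
    using that by simp
  moreover have "(t(Suc n := y)) (Suc n) = y" "(t(Suc n := y)) (Suc n - 1) = t n"
      "(t(Suc n := y)) 1 = t 1"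
    using assms by simp_all
  ultimately show ?thesis
    by (simp only: simplex_ineqs_def greaterThanLessThan_iff ball_simps) blast
qed

text \<open>Only the factor with index \<open>Suc n\<close> sees the new coordinate, so everything
  else is constant for the inner integral.\<close>

lemma Phi_tilde_Suc:
  assumes "n \<ge> 1"
  shows "Phi_tilde (Suc n) \<alpha> \<beta> (t(Suc n := y)) =
    Phi_tilde n \<alpha> \<beta> t * (y powr \<alpha> (Suc n) * (t n - y) powr \<beta> (Suc n))"
proof -
  have "(\<Prod>j=2..n. (t(Suc n := y)) j powr \<alpha> j *
        ((t(Suc n := y)) (j - 1) - (t(Suc n := y)) j) powr \<beta> j) =
      (\<Prod>j=2..n. t j powr \<alpha> j * (t (j - 1) - t j) powr \<beta> j)"
    by (intro prod.cong) auto
  with assms show ?thesis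
    by (simp add: Phi_tilde_def prod.nat_ivl_Suc' mult_ac)
qed

text \<open>Turns the power of \<open>t n\<close> left by the inner integral into a change of
  parameter, so that the recursion stays within the same family of integrands.\<close>

lemma Phi_tilde_shift_last:
  assumes "n \<ge> 1"
  shows "Phi_tilde n (\<alpha>(n := \<alpha> n + d)) \<beta> t = Phi_tilde n \<alpha> \<beta> t * t n powr d"
proof (cases "n = 1")
  \<comment> \<open>For \<open>n = 1\<close> the modified exponent sits in front of the product, not
    inside it.\<close>
  case True
  then show ?thesis by (simp add: Phi_tilde_def powr_add)
next
  case False
  with assms obtain m where n: "n = Suc m" "m \<ge> 1" by (cases n) auto
  have "(\<Prod>j=2..m. t j powr (\<alpha>(Suc m := \<alpha> (Suc m) + d)) j * (t (j - 1) - t j) powr \<beta> j) =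
      (\<Prod>j=2..m. t j powr \<alpha> j * (t (j - 1) - t j) powr \<beta> j)"
    by (intro prod.cong) auto
  with n show ?thesis
    by (simp add: Phi_tilde_def prod.nat_ivl_Suc' powr_add mult_ac)
qed

section \<open>Nonnegativity and measurability\<close>

lemma Phi_tilde_nonneg: "0 \<le> Phi_tilde n \<alpha> \<beta> t"
  by (simp add: Phi_tilde_def prod_nonneg)

lemma measurable_lebesgue_R_component:
  assumes "j \<in> {1..n}"
  shows "(\<lambda>t. t j) \<in> borel_measurable (lebesgue_R n)"
  using measurable_component_singleton[OF assms, of "\<lambda>_. lborel"] by (simp add: lebesgue_R_def)

lemma sets_ordered_simplex [measurable]:
  assumes "n \<ge> 1"
  shows "ordered_simplex n \<in> sets (lebesgue_R n)"
proof -
  note coord = measurable_lebesgue_R_component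
  have "Measurable.pred (lebesgue_R n) (\<lambda>t. \<forall>j\<in>{2..n}. t j < t (j - 1))"
    by (intro pred_intros_finite borel_measurable_pred_less coord) auto
  moreover have "Measurable.pred (lebesgue_R n) (\<lambda>t. 0 < t n)"
      "Measurable.pred (lebesgue_R n) (\<lambda>t. t 1 < 1)"
    using assms by (intro borel_measurable_pred_less borel_measurable_const coord; simp)+
  ultimately show ?thesis
    unfolding ordered_simplex_eq simplex_ineqs_def by (intro pred_intros_logic predE) auto
qed

lemma measurable_Phi_tilde [measurable]:
  assumes "n \<ge> 1"
  shows "Phi_tilde n \<alpha> \<beta> \<in> borel_measurable (lebesgue_R n)"
proof -
  note coord = measurable_lebesgue_R_component
  show ?thesis
    unfolding Phi_tilde_def using assms
    by (intro borel_measurable_times borel_measurable_prod powr_real_measurable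
        borel_measurable_diff borel_measurable_const coord) auto
qed

section \<open>Tonelli and the recursion in the dimension\<close>

lemma nn_integral_lebesgue_R_Suc:
  assumes "f \<in> borel_measurable (lebesgue_R (Suc n))"
  shows "(\<integral>\<^sup>+t. f t \<partial>lebesgue_R (Suc n)) =
    (\<integral>\<^sup>+t. (\<integral>\<^sup>+y. f (t(Suc n := y)) \<partial>lborel) \<partial>lebesgue_R n)"
proof -
  interpret product_sigma_finite "\<lambda>_::nat. lborel :: real measure"
    by standard
  have "{1..Suc n} = insert (Suc n) {1..n}" by auto
  with assms show ?thesis
    unfolding lebesgue_R_def by (simp add: product_nn_integral_insert)
qed

lemma nn_integral_Phi_tilde_Suc:
  assumes "n \<ge> 1" "\<alpha> (Suc n) > -1" "\<beta> (Suc n) > -1"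
  defines "d \<equiv> \<alpha> (Suc n) + \<beta> (Suc n) + 1"
  shows "(\<integral>\<^sup>+t\<in>ordered_simplex (Suc n). Phi_tilde (Suc n) \<alpha> \<beta> t \<partial>lebesgue_R (Suc n)) =
    ennreal (Beta (\<alpha> (Suc n) + 1) (\<beta> (Suc n) + 1)) *
    (\<integral>\<^sup>+t\<in>ordered_simplex n. Phi_tilde n (\<alpha>(n := \<alpha> n + d)) \<beta> t \<partial>lebesgue_R n)"
proof -
  let ?B = "Beta (\<alpha> (Suc n) + 1) (\<beta> (Suc n) + 1)"
  have [simp]: "?B \<ge> 0"
    using assms Beta_real_pos[of "\<alpha> (Suc n) + 1" "\<beta> (Suc n) + 1"] by simp
  have "(\<integral>\<^sup>+t\<in>ordered_simplex (Suc n). Phi_tilde (Suc n) \<alpha> \<beta> t \<partial>lebesgue_R (Suc n)) =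
    (\<integral>\<^sup>+t. (\<integral>\<^sup>+y. ennreal (Phi_tilde (Suc n) \<alpha> \<beta> (t(Suc n := y))) *
      indicator (ordered_simplex (Suc n)) (t(Suc n := y)) \<partial>lborel) \<partial>lebesgue_R n)"
    by (intro nn_integral_lebesgue_R_Suc) measurable
  also have "\<dots> = (\<integral>\<^sup>+t. ennreal ?B * (ennreal (Phi_tilde n (\<alpha>(n := \<alpha> n + d)) \<beta> t) *
      indicator (ordered_simplex n) t) \<partial>lebesgue_R n)"
  proof (intro nn_integral_cong)
    fix t assume t: "t \<in> space (lebesgue_R n)"
    \<comment> \<open>Extensionality survives the update, so membership in the larger simplex comes
      down to the inequalities.\<close>
    have "t(Suc n := y) \<in> space (lebesgue_R (Suc n))" for y
      using t by (auto simp: lebesgue_R_def space_PiM PiE_def extensional_def)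
    then have mem: "t(Suc n := y) \<in> ordered_simplex (Suc n) \<longleftrightarrow>
        t \<in> ordered_simplex n \<and> y \<in> {0<..<t n}" for y
      using t assms(1) by (auto simp: ordered_simplex_eq simplex_ineqs_Suc)
    show "(\<integral>\<^sup>+y. ennreal (Phi_tilde (Suc n) \<alpha> \<beta> (t(Suc n := y))) *
        indicator (ordered_simplex (Suc n)) (t(Suc n := y)) \<partial>lborel) =
      ennreal ?B * (ennreal (Phi_tilde n (\<alpha>(n := \<alpha> n + d)) \<beta> t) *
        indicator (ordered_simplex n) t)"
    proof (cases "t \<in> ordered_simplex n")
      case True
      then have tn: "t n > 0" by (simp add: ordered_simplex_def)
      \<comment> \<open>Over a point of the smaller simplex the fibre is the interval from 0 to
        \<open>t n\<close>; over any other point it is empty and both sides vanish.\<close>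
      have "(\<integral>\<^sup>+y. ennreal (Phi_tilde (Suc n) \<alpha> \<beta> (t(Suc n := y))) *
          indicator (ordered_simplex (Suc n)) (t(Suc n := y)) \<partial>lborel) =
        (\<integral>\<^sup>+y. ennreal (Phi_tilde n \<alpha> \<beta> t) *
          (ennreal (y powr \<alpha> (Suc n) * (t n - y) powr \<beta> (Suc n)) *
            indicator {0<..<t n} y) \<partial>lborel)"
        using True assms(1)
        by (intro nn_integral_cong)
          (auto simp: mem Phi_tilde_Suc indicator_def ennreal_mult Phi_tilde_nonneg)
      also have "\<dots> = ennreal (Phi_tilde n \<alpha> \<beta> t) * ennreal (t n powr d * ?B)"
        using assms tn by (subst nn_integral_cmult) (auto simp: nn_integral_Beta_scaled)
      finally show ?thesis
        using True assms(1)
        by (simp add: Phi_tilde_shift_last Phi_tilde_nonneg ennreal_mult'[symmetric] mult_ac)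
    qed (simp add: mem)
  qed
  also have "\<dots> = ennreal ?B *
      (\<integral>\<^sup>+t\<in>ordered_simplex n. Phi_tilde n (\<alpha>(n := \<alpha> n + d)) \<beta> t \<partial>lebesgue_R n)"
    using assms(1) by (intro nn_integral_cmult) measurable
  finally show ?thesis .
qed

text \<open>A product over a one-element index set is integrated through its only coordinate,
  leaving the Beta integral with \<open>c = 1\<close>.\<close>

lemma nn_integral_Phi_tilde_1:
  assumes "\<alpha> 1 > -1" "\<beta> 1 > -1"
  shows "(\<integral>\<^sup>+t\<in>ordered_simplex 1. Phi_tilde 1 \<alpha> \<beta> t \<partial>lebesgue_R 1) =
    ennreal (Beta (\<alpha> 1 + 1) (\<beta> 1 + 1))"
proof -
  interpret product_sigma_finite "\<lambda>_::nat. lborel :: real measure"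
    by standard
  have "(\<integral>\<^sup>+t\<in>ordered_simplex 1. Phi_tilde 1 \<alpha> \<beta> t \<partial>lebesgue_R 1) =
      (\<integral>\<^sup>+t. ennreal (t 1 powr \<alpha> 1 * (1 - t 1) powr \<beta> 1) * indicator {0<..<1} (t 1) \<partial>lebesgue_R 1)"
    by (intro nn_integral_cong)
      (auto simp: ordered_simplex_eq simplex_ineqs_def Phi_tilde_def indicator_def)
  also have "\<dots> = (\<integral>\<^sup>+y. ennreal (y powr \<alpha> 1 * (1 - y) powr \<beta> 1) * indicator {0<..<1} y \<partial>lborel)"
    unfolding lebesgue_R_def
    using product_nn_integral_singleton[of "\<lambda>y. ennreal (y powr \<alpha> 1 * (1 - y) powr \<beta> 1) * indicator {0<..<1} y" 1]
    by simp
  also have "\<dots> = ennreal (Beta (\<alpha> 1 + 1) (\<beta> 1 + 1))"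
    using nn_integral_Beta_scaled[of "\<alpha> 1" "\<beta> 1" 1] assms by simp
  finally show ?thesis .
qed

section \<open>The Gamma factors and the induction\<close>

definition Gamma_factor :: "nat \<Rightarrow> (nat \<Rightarrow> real) \<Rightarrow> (nat \<Rightarrow> real) \<Rightarrow> nat \<Rightarrow> real" where
  "Gamma_factor n \<alpha> \<beta> j =
     Gamma (\<beta> j + 1) *
     Gamma ((\<Sum>i=j..n. \<alpha> i) + (\<Sum>i=j+1..n. \<beta> i) + real n - real j + 1) /
     Gamma ((\<Sum>i=j..n. \<alpha> i) + (\<Sum>i=j..n. \<beta> i) + real n - real j + 2)"

text \<open>For \<open>j = n\<close> the sum of the later \<open>\<beta> i\<close> is empty, and the
  denominator has argument \<open>(\<alpha> n + 1) + (\<beta> n + 1)\<close>.\<close>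

lemma Gamma_factor_last:
  "Gamma_factor n \<alpha> \<beta> n = Beta (\<alpha> n + 1) (\<beta> n + 1)"
  by (simp add: Gamma_factor_def Beta_def add_ac mult_ac)

text \<open>Passing from \<open>n\<close> to \<open>Suc n\<close> adds the two new exponents and 1
  to both long Gamma arguments. Since \<open>n\<close> lies in \<open>{j..n}\<close>, the shift of
  \<open>\<alpha> n\<close> adds the same amount, exactly once.\<close>

lemma Gamma_factor_Suc:
  assumes "j \<le> n"
  shows "Gamma_factor (Suc n) \<alpha> \<beta> j =
    Gamma_factor n (\<alpha>(n := \<alpha> n + (\<alpha> (Suc n) + \<beta> (Suc n) + 1))) \<beta> j"
proof -
  define d where "d = \<alpha> (Suc n) + \<beta> (Suc n) + 1"
  have "{j..n} = insert n {j..<n}" "n \<notin> {j..<n}"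
    using assms by auto
  then have "(\<Sum>i=j..n. (\<alpha>(n := \<alpha> n + d)) i) = (\<Sum>i=j..n. \<alpha> i) + d"
    by (simp add: add_ac)
  with assms show ?thesis
    unfolding Gamma_factor_def d_def[symmetric]
    by (simp del: fun_upd_apply add: d_def algebra_simps)
qed

text \<open>Nonnegativity of the product is carried along because \<open>ennreal\<close> truncates
  negative numbers to 0. The induction generalises over \<open>\<alpha>\<close>, since the recursion
  changes it.\<close>

lemma nn_integral_Phi_tilde:
  assumes "n \<ge> 1"
    and "\<And>i. i \<in> {1..n} \<Longrightarrow> \<alpha> i > 0"
    and "\<And>i. i \<in> {1..n} \<Longrightarrow> \<beta> i > 0"
  shows "(\<integral>\<^sup>+t\<in>ordered_simplex n. Phi_tilde n \<alpha> \<beta> t \<partial>lebesgue_R n) =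
      ennreal (\<Prod>j=1..n. Gamma_factor n \<alpha> \<beta> j) \<and> 0 \<le> (\<Prod>j=1..n. Gamma_factor n \<alpha> \<beta> j)"
  using assms
proof (induction n arbitrary: \<alpha> rule: nat_induct_at_least)
  case base
  have "Beta (\<alpha> 1 + 1) (\<beta> 1 + 1) \<ge> 0"
    using base[of 1] Beta_real_pos[of "\<alpha> 1 + 1" "\<beta> 1 + 1"] by simp
  with base[of 1] show ?case
    using nn_integral_Phi_tilde_1[of \<alpha> \<beta>] by (simp add: Gamma_factor_last)
next
  case (Suc n)
  define \<alpha>' where "\<alpha>' = \<alpha>(n := \<alpha> n + (\<alpha> (Suc n) + \<beta> (Suc n) + 1))"
  let ?B = "Beta (\<alpha> (Suc n) + 1) (\<beta> (Suc n) + 1)"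
  have pos: "\<alpha> (Suc n) > 0" "\<beta> (Suc n) > 0" "\<alpha> n > 0"
    using Suc.prems Suc.hyps by auto
  then have B: "?B \<ge> 0"
    using Beta_real_pos[of "\<alpha> (Suc n) + 1" "\<beta> (Suc n) + 1"] by simp
  \<comment> \<open>The shift of \<open>\<alpha> n\<close> is positive, so the hypotheses pass to
    the new exponents.\<close>
  have "\<alpha>' i > 0" if "i \<in> {1..n}" for i
    using Suc.prems(1)[of i] pos that by (simp add: \<alpha>'_def)
  then have IH: "(\<integral>\<^sup>+t\<in>ordered_simplex n. Phi_tilde n \<alpha>' \<beta> t \<partial>lebesgue_R n) =
      ennreal (\<Prod>j=1..n. Gamma_factor n \<alpha>' \<beta> j) \<and> 0 \<le> (\<Prod>j=1..n. Gamma_factor n \<alpha>' \<beta> j)"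
    using Suc.prems by (intro Suc.IH) auto
  have "(\<Prod>j=1..Suc n. Gamma_factor (Suc n) \<alpha> \<beta> j) =
      ?B * (\<Prod>j=1..n. Gamma_factor n \<alpha>' \<beta> j)"
    by (simp add: Gamma_factor_last Gamma_factor_Suc \<alpha>'_def mult_ac)
  moreover have "(\<integral>\<^sup>+t\<in>ordered_simplex (Suc n). Phi_tilde (Suc n) \<alpha> \<beta> t \<partial>lebesgue_R (Suc n)) =
      ennreal ?B * (\<integral>\<^sup>+t\<in>ordered_simplex n. Phi_tilde n \<alpha>' \<beta> t \<partial>lebesgue_R n)"
    using nn_integral_Phi_tilde_Suc[of n \<alpha> \<beta>] Suc.hyps pos by (simp add: \<alpha>'_def)
  ultimately show ?case
    using IH B by (simp add: ennreal_mult)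
qed

theorem theorem1:
  fixes n :: nat and \<alpha> \<beta> :: "nat \<Rightarrow> real"
  assumes "n \<ge> 1"
    and "\<And>i. i \<in> {1..n} \<Longrightarrow> \<alpha> i > 0"
    and "\<And>i. i \<in> {1..n} \<Longrightarrow> \<beta> i > 0"
  shows "(LINT t:ordered_simplex n|lebesgue_R n. Phi_tilde n \<alpha> \<beta> t) =
    (\<Prod>j=1..n.
       Gamma (\<beta> j + 1) *
       Gamma ((\<Sum>i=j..n. \<alpha> i) + (\<Sum>i=j+1..n. \<beta> i) + real n - real j + 1) /
       Gamma ((\<Sum>i=j..n. \<alpha> i) + (\<Sum>i=j..n. \<beta> i) + real n - real j + 2))"
proof -
  \<comment> \<open>For a nonnegative measurable integrand this holds even without integrability,
    \<open>enn2real\<close> sending infinity to 0; the value found by the induction is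
    finite.\<close>
  have "(LINT t:ordered_simplex n|lebesgue_R n. Phi_tilde n \<alpha> \<beta> t) =
      enn2real (\<integral>\<^sup>+t. ennreal (indicator (ordered_simplex n) t *\<^sub>R Phi_tilde n \<alpha> \<beta> t) \<partial>lebesgue_R n)"
    unfolding set_lebesgue_integral_def using assms(1)
    by (intro integral_eq_nn_integral) (auto simp: Phi_tilde_nonneg)
  also have "(\<integral>\<^sup>+t. ennreal (indicator (ordered_simplex n) t *\<^sub>R Phi_tilde n \<alpha> \<beta> t) \<partial>lebesgue_R n) =
      (\<integral>\<^sup>+t\<in>ordered_simplex n. Phi_tilde n \<alpha> \<beta> t \<partial>lebesgue_R n)"
    by (intro nn_integral_cong) (auto simp: indicator_def)
  finally have "(LINT t:ordered_simplex n|lebesgue_R n. Phi_tilde n \<alpha> \<beta> t) =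
      (\<Prod>j=1..n. Gamma_factor n \<alpha> \<beta> j)"
    using nn_integral_Phi_tilde[of n \<alpha> \<beta>] assms by simp
  then show ?thesis
    by (simp only: Gamma_factor_def)
qed

end
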